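(* Let $E\subset\mathbb R^2$ be a compact set with $\dim(E)>1$ and let $\mu$ be an $\alpha$-Frostman measure on $E$ for some $\alpha>1$. Let $E_1,E_2,E_3$ be (pairwise) disjoint compact subsets of $E$ with $\mu(E_i)>0$ for $i=1,2,3$. Then for $\mu_{E_1}\times\mu_{E_2}$-almost every pair $(x_1,x_2)\in E_1\times E_2$, $$\mathcal L^1\big(\{\mathrm{Area}(x_1,x_2,x_3): x_3\in E_3\}\big)>0.$$
   Context: $\dim$ is Hausdorff dimension and $\mathcal L^1$ is Lebesgue measure on $\mathbb R$. $\mathrm{Area}(x_1,x_2,x_3)$ is the area of the triangle with vertices $x_1,x_2,x_3$. An $\alpha$-Frostman measure on a compact set $E\subset\mathbb R^2$ is a nonzero finite Borel measure $\mu$ supported on $E$ for which there is a constant $C$ with $\mu(B(x,r))\le Cr^\alpha$ for all $x\in\mathbb R^2$, $r>0$. For compact $F\subset E$, $\mu_F$ is the restriction $\mu_F(A)=\mu(A\cap F)$. *)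

theory Defs
  imports "HOL-Analysis.Analysis"
begin

text \<open>
  The gauge \<open>diam(U)\<^sup>s\<close>, with the usual conventions that the empty set contributes \<open>0\<close> for every
  \<open>s\<close> and that a nonempty set contributes \<open>1\<close> for \<open>s = 0\<close>. The latter has to be spelled out, since
  \<^term>\<open>0 powr 0 = (0::real)\<close>.
\<close>

definition diam_pow :: "real \<Rightarrow> 'a::metric_space set \<Rightarrow> ennreal" where
  "diam_pow s U = (if U = {} then 0 else if s = 0 then 1 else ennreal (diameter U powr s))"

text \<open>Boundedness is required because \<^const>\<open>diameter\<close> is meaningless on unbounded sets.\<close>

definition delta_covers :: "real \<Rightarrow> 'a::metric_space set \<Rightarrow> (nat \<Rightarrow> 'a set) set" where
  "delta_covers d A = {U. A \<subseteq> (\<Union>i. U i) \<and> (\<forall>i. bounded (U i) \<and> diameter (U i) \<le> d)}"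

definition hausdorff_content :: "real \<Rightarrow> real \<Rightarrow> 'a::metric_space set \<Rightarrow> ennreal" where
  "hausdorff_content s d A = (INF U\<in>delta_covers d A. \<Sum>i. diam_pow s (U i))"

definition hausdorff_measure :: "real \<Rightarrow> 'a::metric_space set \<Rightarrow> ennreal" where
  "hausdorff_measure s A = (SUP d\<in>{0<..}. hausdorff_content s d A)"

definition hausdorff_dim :: "'a::metric_space set \<Rightarrow> ereal" where
  "hausdorff_dim A = (INF s\<in>{s. 0 \<le> s \<and> hausdorff_measure s A = 0}. ereal s)"

text \<open>
  For closed \<open>E\<close> in a Euclidean space, \<open>\<mu>\<close> is supported on \<open>E\<close> iff the complement of \<open>E\<close> is
  \<open>\<mu>\<close>-null.
\<close>

definition frostman_measure :: "real \<Rightarrow> 'a::metric_space set \<Rightarrow> 'a measure \<Rightarrow> bool" where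
  "frostman_measure \<alpha> E \<mu> \<longleftrightarrow>
     sets \<mu> = sets borel \<and> finite_measure \<mu> \<and> emeasure \<mu> UNIV \<noteq> 0 \<and> emeasure \<mu> (- E) = 0 \<and>
     (\<exists>C. \<forall>x r. r > 0 \<longrightarrow> measure \<mu> (cball x r) \<le> C * r powr \<alpha>)"

definition restrict_measure :: "'a measure \<Rightarrow> 'a set \<Rightarrow> 'a measure" where
  "restrict_measure \<mu> F = density \<mu> (indicator F)"

lemma sets_restrict_measure [simp, measurable_cong]: "sets (restrict_measure \<mu> F) = sets \<mu>"
  by (simp add: restrict_measure_def)

lemma emeasure_restrict_measure:
  assumes "F \<in> sets \<mu>" "A \<in> sets \<mu>"
  shows "emeasure (restrict_measure \<mu> F) A = emeasure \<mu> (A \<inter> F)"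
  using emeasure_restricted[OF assms] by (simp add: restrict_measure_def Int_commute)

definition triangle_area :: "real ^ 2 \<Rightarrow> real ^ 2 \<Rightarrow> real ^ 2 \<Rightarrow> real" where
  "triangle_area x y z = measure lebesgue (convex hull {x, y, z})"

end

theory Submission
  imports Defs
begin

text \<open>
  Up to an affine rescaling and an absolute value, the set of areas with base \<open>x\<^sub>1 x\<^sub>2\<close> is the
  projection of \<open>E\<^sub>3\<close> along the line \<open>x\<^sub>1 x\<^sub>2\<close>. If the projection of \<open>\<mu>\<close> in direction \<open>t\<close> has an
  \<open>L\<^sup>2\<close> density, that is, if \<open>4\<^sup>n\<close> times the integral over \<open>s\<close> of its squared mass on
  \<open>[s, s + 2\<^sup>-\<^sup>n)\<close> stays bounded, then Cauchy-Schwarz gives the projection of \<open>E\<^sub>3\<close> positive measure.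
  So it suffices that almost no pair points in a direction \<open>t\<close> for which the supremum
  \<open>F(t)\<close> of these discretised energies is infinite.

  The discretised energies increase with \<open>n\<close>, and their integrals over \<open>t\<close> are bounded by a multiple
  of the 1-energy of \<open>\<mu>\<close>, which is finite because \<open>\<alpha> > 1\<close>; hence \<open>F\<close> is integrable. Written as
  double integrals over pairs \<open>(x, y)\<close>, the same energies concentrate, as \<open>n\<close> grows, on the
  direction of \<open>x - y\<close>. By Fatou's lemma the weighted measure of the pairs with direction in
  the open set \<open>{F > R}\<close> is at most the integral of \<open>F\<close> over \<open>{F > R}\<close>, which tends to \<open>0\<close> as
  \<open>R\<close> grows.
\<close>

section \<open>Discretised energy on the line\<close>

text \<open>The squared L2 norm of the average density of \<open>m\<close> over windows of length
  \<open>2^-n\<close>. When \<open>m\<close> has an L2 density, it approximates the squared norm of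
  that density as \<open>n\<close> grows.\<close>

definition dyadic_energy :: "nat \<Rightarrow> real measure \<Rightarrow> ennreal" where
  "dyadic_energy n m = 4 ^ n * (\<integral>\<^sup>+s. (emeasure m {s..<s + 1 / 2 ^ n})\<^sup>2 \<partial>lborel)"

text \<open>The cut-off comes from \<open>ennreal\<close>, which sends negative reals to 0. The
  result is the autocorrelation of a window of length \<open>2^-n\<close>, scaled to have integral
  1.\<close>

definition tent :: "nat \<Rightarrow> real \<Rightarrow> ennreal" where
  "tent n d = ennreal (2 ^ n * (1 - 2 ^ n * \<bar>d\<bar>))"

lemma measurable_tent [measurable]: "tent n \<in> borel_measurable borel"
  unfolding tent_def by measurable

text \<open>A condition on the pair \<open>s\<close>, \<open>x\<close> rather than the indicator of
  a set depending on \<open>s\<close>, so that joint measurability is automatic when Fubini is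
  applied.\<close>

definition in_window :: "real \<Rightarrow> real \<Rightarrow> real \<Rightarrow> ennreal" where
  "in_window d s x = (if s \<le> x \<and> x < s + d then 1 else 0)"

lemma measurable_in_window [measurable (raw)]:
  assumes [measurable]: "f \<in> borel_measurable M" "g \<in> borel_measurable M"
  shows "(\<lambda>w. in_window d (f w) (g w)) \<in> borel_measurable M"
  unfolding in_window_def by measurable

lemma emeasure_window_eq_integral:
  assumes "sets m = sets (borel :: real measure)"
  shows "emeasure m {s..<s + d} = (\<integral>\<^sup>+x. in_window d s x \<partial>m)"
proof -
  have "emeasure m {s..<s + d} = (\<integral>\<^sup>+x. indicator {s..<s + d} x \<partial>m)"
    by (simp add: assms)
  also have "\<dots> = (\<integral>\<^sup>+x. in_window d s x \<partial>m)"
    by (intro nn_integral_cong) (simp add: in_window_def split: split_indicator)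
  finally show ?thesis .
qed

lemma measurable_emeasure_window:
  assumes "finite_measure m" and [measurable_cong]: "sets m = sets (borel :: real measure)"
  shows "(\<lambda>s. emeasure m {s..<s + d}) \<in> borel_measurable borel"
proof -
  interpret finite_measure m by fact
  show ?thesis unfolding emeasure_window_eq_integral[OF assms(2)] by measurable
qed

text \<open>A window splits into two adjacent windows of half the length, and
  \<open>(a + b)^2 <= 2 * a^2 + 2 * b^2\<close>. By translation invariance both halves have the same
  integral, so the total loss is the factor 4 between \<open>4 ^ n\<close> and
  \<open>4 ^ Suc n\<close>.\<close>

lemma dyadic_energy_Suc:
  assumes "finite_measure m" and [measurable_cong]: "sets m = sets (borel :: real measure)"
  shows "dyadic_energy n m \<le> dyadic_energy (Suc n) m"
proof -
  interpret finite_measure m by fact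
  define d :: real where "d = 1 / 2 ^ Suc n"
  define f where "f s = (emeasure m {s..<s + d})\<^sup>2" for s
  have [measurable]: "f \<in> borel_measurable borel"
    unfolding f_def using measurable_emeasure_window[OF assms] by measurable
  have d: "1 / 2 ^ n = d + d" "d > 0" by (auto simp: d_def)
  have sq: "(a + b)\<^sup>2 \<le> 2 * a\<^sup>2 + 2 * b\<^sup>2" if fin: "a \<noteq> top" "b \<noteq> top" for a b :: ennreal
  proof -
    obtain a' b' where ab: "a = ennreal a'" "0 \<le> a'" "b = ennreal b'" "0 \<le> b'"
      using fin by (cases a; cases b) auto
    have "(a' + b')\<^sup>2 \<le> 2 * a'\<^sup>2 + 2 * b'\<^sup>2"
      using zero_le_power2[of "a' - b'"] by (simp add: power2_eq_square algebra_simps)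
    then have "ennreal ((a' + b')\<^sup>2) \<le> ennreal (2 * a'\<^sup>2 + 2 * b'\<^sup>2)" by (rule ennreal_leI)
    moreover have "(a + b)\<^sup>2 = ennreal ((a' + b')\<^sup>2)"
      using ab by (simp add: ennreal_power flip: ennreal_plus)
    moreover have "2 * a\<^sup>2 + 2 * b\<^sup>2 = ennreal (2 * a'\<^sup>2 + 2 * b'\<^sup>2)"
      using ab by (simp add: ennreal_power ennreal_mult')
    ultimately show ?thesis by simp
  qed
  have "(\<integral>\<^sup>+s. (emeasure m {s..<s + 1 / 2 ^ n})\<^sup>2 \<partial>lborel) \<le> (\<integral>\<^sup>+s. 2 * f s + 2 * f (s + d) \<partial>lborel)"
  proof (rule nn_integral_mono)
    fix s
    have "{s..<s + 1 / 2 ^ n} = {s..<s + d} \<union> {s + d..<s + d + d}"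
      using d by auto
    then have "emeasure m {s..<s + 1 / 2 ^ n} = emeasure m {s..<s + d} + emeasure m {s + d..<s + d + d}"
      by (simp add: plus_emeasure assms disjoint_iff)
    then show "(emeasure m {s..<s + 1 / 2 ^ n})\<^sup>2 \<le> 2 * f s + 2 * f (s + d)"
      by (simp add: f_def sq)
  qed
  also have "\<dots> = 2 * (\<integral>\<^sup>+s. f s \<partial>lborel) + 2 * (\<integral>\<^sup>+s. f (s + d) \<partial>lborel)"
    by (simp add: nn_integral_add nn_integral_cmult)
  also have "(\<integral>\<^sup>+s. f (s + d) \<partial>lborel) = (\<integral>\<^sup>+s. f s \<partial>lborel)"
    using nn_integral_real_affine[of f 1 d] by (simp add: add.commute)
  finally have "(\<integral>\<^sup>+s. (emeasure m {s..<s + 1 / 2 ^ n})\<^sup>2 \<partial>lborel) \<le> 4 * (\<integral>\<^sup>+s. f s \<partial>lborel)"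
    by (simp add: distrib_right[symmetric])
  then show ?thesis
    unfolding dyadic_energy_def f_def d_def
    by (simp add: mult.assoc mult_left_mono power_Suc2 del: power_Suc)
qed

text \<open>Expand the square into a double integral and integrate over \<open>s\<close> first. The
  starting points of windows of length \<open>d\<close> containing both \<open>x\<close> and
  \<open>y\<close> form an interval of length \<open>d - \<bar>x - y\<bar>\<close>, or the empty
  set.\<close>

lemma dyadic_energy_eq_tent:
  assumes "finite_measure m" and [measurable_cong]: "sets m = sets (borel :: real measure)"
  shows "dyadic_energy n m = (\<integral>\<^sup>+x. \<integral>\<^sup>+y. tent n (x - y) \<partial>m \<partial>m)"
proof -
  interpret finite_measure m by fact
  interpret P: pair_sigma_finite m lborel ..
  define d :: real where "d = 1 / 2 ^ n"
  have "d > 0" by (simp add: d_def)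
  let ?g = "in_window d"
  have emeas: "emeasure m {s..<s + d} = (\<integral>\<^sup>+x. ?g s x \<partial>m)" for s
    by (rule emeasure_window_eq_integral) fact
  have inner: "(\<integral>\<^sup>+s. ?g s x * ?g s y \<partial>lborel) = ennreal (d - \<bar>x - y\<bar>)" for x y
  proof -
    have "(\<integral>\<^sup>+s. ?g s x * ?g s y \<partial>lborel) = (\<integral>\<^sup>+s. indicator {max x y - d<..min x y} s \<partial>lborel)"
      by (intro nn_integral_cong) (auto simp: in_window_def split: split_indicator)
    also have "\<dots> = ennreal (d - \<bar>x - y\<bar>)"
    proof (cases "max x y - d \<le> min x y")
      case True
      moreover have "min x y - (max x y - d) = d - \<bar>x - y\<bar>" by linarith
      moreover have "(\<integral>\<^sup>+s. indicator {max x y - d<..min x y} s \<partial>lborel) = ennreal (min x y - (max x y - d))"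
        using True by (simp only: nn_integral_indicator sets_lborel greaterThanAtMost_borel emeasure_lborel_Ioc)
      ultimately show ?thesis by (simp only:)
    next
      case False
      then have "d - \<bar>x - y\<bar> \<le> 0" "{max x y - d<..min x y} = {}" by (auto simp: max_def min_def abs_if split: if_splits)
      then show ?thesis by (simp add: ennreal_neg)
    qed
    finally show ?thesis .
  qed
  have "(\<integral>\<^sup>+s. (emeasure m {s..<s + d})\<^sup>2 \<partial>lborel) = (\<integral>\<^sup>+s. \<integral>\<^sup>+x. \<integral>\<^sup>+y. ?g s x * ?g s y \<partial>m \<partial>m \<partial>lborel)"
    by (intro nn_integral_cong) (simp add: emeas power2_eq_square nn_integral_cmult nn_integral_multc)
  also have "\<dots> = (\<integral>\<^sup>+x. \<integral>\<^sup>+s. \<integral>\<^sup>+y. ?g s x * ?g s y \<partial>m \<partial>lborel \<partial>m)"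
    by (rule P.Fubini') simp
  also have "\<dots> = (\<integral>\<^sup>+x. \<integral>\<^sup>+y. \<integral>\<^sup>+s. ?g s x * ?g s y \<partial>lborel \<partial>m \<partial>m)"
    by (intro nn_integral_cong P.Fubini') simp
  also have "\<dots> = (\<integral>\<^sup>+x. \<integral>\<^sup>+y. ennreal (d - \<bar>x - y\<bar>) \<partial>m \<partial>m)"
    by (simp add: inner)
  finally have *: "(\<integral>\<^sup>+s. (emeasure m {s..<s + d})\<^sup>2 \<partial>lborel) = (\<integral>\<^sup>+x. \<integral>\<^sup>+y. ennreal (d - \<bar>x - y\<bar>) \<partial>m \<partial>m)" .
  have t: "tent n u = 4 ^ n * ennreal (d - \<bar>u\<bar>)" for u
  proof -
    have "2 ^ n * (1 - 2 ^ n * \<bar>u\<bar>) = 4 ^ n * (d - \<bar>u\<bar>)"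
      by (simp add: d_def field_simps flip: power_mult_distrib)
    moreover have "(4 :: ennreal) ^ n = ennreal (4 ^ n)" by (simp add: ennreal_power flip: ennreal_numeral)
    ultimately show ?thesis
      by (simp add: tent_def ennreal_mult')
  qed
  show ?thesis
    unfolding dyadic_energy_def t using *
    by (simp add: nn_integral_cmult d_def)
qed

text \<open>If \<open>K\<close> were null, it would lie in an open \<open>U\<close> of length at
  most \<open>e\<close>. Windows short enough to start in \<open>U\<close> whenever they meet
  \<open>K\<close> recover the mass of \<open>K\<close> from an integral over \<open>U\<close>, and
  Cauchy-Schwarz bounds the square of that mass by \<open>e\<close> times the energy bound.\<close>

lemma emeasure_compact_pos_if_dyadic_energy_bounded:
  assumes fin: "finite_measure m" and [measurable_cong]: "sets m = sets (borel :: real measure)"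
    and bdd: "(SUP n. dyadic_energy n m) < top" and "compact K" and K: "emeasure m K > 0"
  shows "emeasure lborel K > 0"
proof (rule ccontr)
  assume "\<not> emeasure lborel K > 0"
  then have null: "emeasure lborel K = 0" by (simp add: zero_less_iff_neq_zero)
  interpret finite_measure m by fact
  interpret P: pair_sigma_finite m lborel ..
  have [measurable]: "K \<in> sets borel" using \<open>compact K\<close> by (simp add: borel_compact)
  define B where "B = (SUP n. dyadic_energy n m)"
  obtain b where b: "B = ennreal b" "0 \<le> b" using bdd unfolding B_def[symmetric] by (cases B) auto
  have key: "(emeasure m K)\<^sup>2 \<le> ennreal (e * b)" if "e > 0" for e :: real
  proof -
    obtain U where U: "open U" "K \<subseteq> U" "emeasure lborel (U - K) \<le> e"
      using outer_regular_lborel_le[of K e] \<open>e > 0\<close> by auto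
    have [measurable]: "U \<in> sets borel" using U by simp
    have "emeasure lborel U \<le> emeasure lborel (U - K) + emeasure lborel K"
      using emeasure_subadditive[of "U - K" lborel K] U by (simp add: Un_absorb2)
    then have Ue: "emeasure lborel U \<le> e" using U null by simp
    obtain r where r: "r > 0" "(\<Union>x\<in>K. ball x r) \<subseteq> U"
      using compact_subset_open_imp_ball_epsilon_subset[OF \<open>compact K\<close> U(1,2)] by blast
    obtain n :: nat where n: "(1 / 2) ^ n < r"
      using real_arch_pow_inv[of r "1 / 2"] r(1) by auto
    define d :: real where "d = 1 / 2 ^ n"
    have d: "0 < d" "d < r" using n by (auto simp: d_def power_divide)
    define g where "g s x = indicator K x * in_window d s x" for s x
    have [measurable]: "(\<lambda>(s, x). g s x) \<in> borel_measurable (borel \<Otimes>\<^sub>M borel)"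
      unfolding g_def by measurable
    define f where "f s = 2 ^ n * emeasure m {s..<s + d}" for s
    have [measurable]: "f \<in> borel_measurable borel"
      unfolding f_def using measurable_emeasure_window[OF fin assms(2)] by measurable
    have f2: "(\<integral>\<^sup>+s. (f s)\<^sup>2 \<partial>lborel) \<le> B"
    proof -
      have "(\<integral>\<^sup>+s. (f s)\<^sup>2 \<partial>lborel) = dyadic_energy n m"
        using measurable_emeasure_window[OF fin assms(2), measurable]
        by (simp add: f_def d_def dyadic_energy_def power_mult_distrib nn_integral_cmult
              power_even_eq[symmetric] flip: power_mult)
           (simp add: power_mult mult.commute[of n 2])
      then show ?thesis unfolding B_def by (metis SUP_upper UNIV_I)
    qed
    \<comment> \<open>A point \<open>x\<close> lies in exactly the windows that start in
      \<open>{x - d<..x}\<close>, an interval of length \<open>d = 1 / 2 ^ n\<close>, so averaging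
      over windows with weight \<open>2 ^ n\<close> reproduces the mass of \<open>K\<close>.\<close>
    have "emeasure m K = (\<integral>\<^sup>+x. indicator K x \<partial>m)" by (simp add: assms)
    also have "\<dots> = (\<integral>\<^sup>+x. 2 ^ n * (\<integral>\<^sup>+s. g s x \<partial>lborel) \<partial>m)"
    proof (intro nn_integral_cong)
      fix x
      have "(\<integral>\<^sup>+s. g s x \<partial>lborel) = (\<integral>\<^sup>+s. indicator K x * indicator {x - d<..x} s \<partial>lborel)"
        by (intro nn_integral_cong) (auto simp: g_def in_window_def split: split_indicator)
      also have "\<dots> = indicator K x * ennreal d"
        using d by (simp add: nn_integral_cmult)
      finally have "2 ^ n * (\<integral>\<^sup>+s. g s x \<partial>lborel) = indicator K x * (ennreal (2 ^ n) * ennreal d)"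
        by (simp add: ac_simps ennreal_power flip: ennreal_numeral)
      also have "ennreal (2 ^ n) * ennreal d = 1"
        by (simp add: d_def flip: ennreal_mult')
      finally show "indicator K x = 2 ^ n * (\<integral>\<^sup>+s. g s x \<partial>lborel)" by simp
    qed
    also have "\<dots> = 2 ^ n * (\<integral>\<^sup>+x. \<integral>\<^sup>+s. g s x \<partial>lborel \<partial>m)"
      by (rule nn_integral_cmult) measurable
    also have "(\<integral>\<^sup>+x. \<integral>\<^sup>+s. g s x \<partial>lborel \<partial>m) = (\<integral>\<^sup>+s. \<integral>\<^sup>+x. g s x \<partial>m \<partial>lborel)"
      by (rule P.Fubini'[symmetric]) measurable
    also have "2 ^ n * \<dots> = (\<integral>\<^sup>+s. 2 ^ n * (\<integral>\<^sup>+x. g s x \<partial>m) \<partial>lborel)"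
      by (rule nn_integral_cmult[symmetric]) measurable
    also have "\<dots> \<le> (\<integral>\<^sup>+s. indicator U s * f s \<partial>lborel)"
    proof (rule nn_integral_mono)
      fix s
      show "2 ^ n * (\<integral>\<^sup>+x. g s x \<partial>m) \<le> indicator U s * f s"
      proof (cases "s \<in> U")
        case True
        have "(\<integral>\<^sup>+x. g s x \<partial>m) \<le> (\<integral>\<^sup>+x. indicator {s..<s + d} x \<partial>m)"
          by (intro nn_integral_mono) (auto simp: g_def in_window_def split: split_indicator)
        then show ?thesis using True by (simp add: f_def assms mult_left_mono)
      next
        case False
        \<comment> \<open>A window that meets \<open>K\<close> starts within \<open>d < r\<close> of
          a point of \<open>K\<close>, hence inside \<open>U\<close>.\<close>
        have "g s x = 0" for x
        proof -
          have "s \<in> U" if "x \<in> K" "s \<le> x" "x < s + d"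
          proof -
            have "s \<in> ball x r" using that d by (simp add: dist_real_def)
            then show ?thesis using r(2) that(1) by blast
          qed
          then show ?thesis using False by (auto simp: g_def in_window_def split: split_indicator)
        qed
        then show ?thesis by simp
      qed
    qed
    finally have "(emeasure m K)\<^sup>2 \<le> (\<integral>\<^sup>+s. indicator U s * f s \<partial>lborel)\<^sup>2"
      by (rule power_mono) simp
    also have "\<dots> \<le> (\<integral>\<^sup>+s. (indicator U s)\<^sup>2 \<partial>lborel) * (\<integral>\<^sup>+s. (f s)\<^sup>2 \<partial>lborel)"
      by (rule Cauchy_Schwarz_nn_integral) auto
    also have "(\<integral>\<^sup>+s. (indicator U s)\<^sup>2 \<partial>lborel) = (\<integral>\<^sup>+s. indicator U s \<partial>lborel)"
      by (intro nn_integral_cong) (simp split: split_indicator)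
    also have "\<dots> * (\<integral>\<^sup>+s. (f s)\<^sup>2 \<partial>lborel) \<le> e * B"
      using Ue f2 by (intro mult_mono) auto
    finally show ?thesis using b \<open>e > 0\<close> by (simp add: ennreal_mult')
  qed
  have "(emeasure m K)\<^sup>2 \<le> 0"
  proof (rule ennreal_le_epsilon)
    fix e :: real assume "e > 0"
    \<comment> \<open>Dividing by \<open>b + 1\<close> rather than by \<open>b\<close> covers the
      case \<open>b = 0\<close>.\<close>
    have "(emeasure m K)\<^sup>2 \<le> ennreal (e / (b + 1) * b)"
      using key[of "e / (b + 1)"] \<open>e > 0\<close> b by simp
    also have "\<dots> \<le> ennreal e"
      using \<open>e > 0\<close> b by (intro ennreal_leI) (simp add: field_simps)
    finally show "(emeasure m K)\<^sup>2 \<le> 0 + ennreal e" by simp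
  qed
  then show False using K by simp
qed

section \<open>Integrals over slopes\<close>

text \<open>Sum over dyadic balls around \<open>x\<close>: the ball of radius \<open>2^-k\<close> is
  weighted by \<open>2^(k+1)\<close> and has mass at most \<open>C * 2^(-k * \<alpha>)\<close>. This
  gives a geometric series of ratio \<open>2^(1 - \<alpha>)\<close>, which is below 1 because
  \<alpha> > 1; the total mass accounts for distances of at least 1.\<close>

lemma inverse_dist_integral_bounded:
  fixes \<mu> :: "'a::{metric_space, second_countable_topology} measure"
  assumes "finite_measure \<mu>" and sets_eq [measurable_cong]: "sets \<mu> = sets borel" and "\<alpha> > 1"
    and ball: "\<And>x r. r > 0 \<Longrightarrow> measure \<mu> (cball x r) \<le> C * r powr \<alpha>"
  obtains B where "B < top" "\<And>x. (\<integral>\<^sup>+y. inverse (ennreal (dist x y)) \<partial>\<mu>) \<le> B"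
proof -
  interpret finite_measure \<mu> by fact
  define q :: real where "q = 2 powr (1 - \<alpha>)"
  have q: "0 < q" "q < 1" using \<open>\<alpha> > 1\<close> by (auto simp: q_def powr_less_one)
  have C: "0 \<le> C" using order_trans[OF measure_nonneg ball[of 1 undefined]] by simp
  define B where "B = emeasure \<mu> (space \<mu>) + (\<Sum>k. ennreal (2 * C * q ^ k))"
  have "summable (\<lambda>k. 2 * C * q ^ k)" using q by (intro summable_mult summable_geometric) auto
  then have "B < top"
    using q C unfolding B_def
    by (subst suminf_ennreal2) (auto simp: less_top[symmetric] emeasure_finite)
  moreover have "(\<integral>\<^sup>+y. inverse (ennreal (dist x y)) \<partial>\<mu>) \<le> B" for x
  proof -
    define f :: "nat \<Rightarrow> 'a \<Rightarrow> ennreal"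
      where "f k y = ennreal (2 ^ Suc k) * indicator (cball x ((1 / 2) ^ k)) y" for k y
    have [measurable]: "f k \<in> borel_measurable \<mu>" for k
      unfolding f_def
      by (intro borel_measurable_times_ennreal borel_measurable_indicator) (simp_all add: sets_eq)
    \<comment> \<open>valid on the diagonal too, where both sides are infinite\<close>
    have pt: "inverse (ennreal (dist x y)) \<le> 1 + (\<Sum>k. f k y)" for y
    proof -
      consider "dist x y = 0" | "0 < dist x y" "dist x y < 1" | "1 \<le> dist x y"
        using zero_le_dist[of x y] by linarith
      then show ?thesis
      proof cases
        case 1
        have "(\<Sum>k. f k y) \<ge> ennreal N" for N :: nat
        proof -
          have "ennreal N = (\<Sum>k<N. 1)" by (simp add: ennreal_of_nat_eq_real_of_nat)
          also have "\<dots> \<le> (\<Sum>k<N. f k y)"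
          proof (intro sum_mono)
            fix k
            have "ennreal 1 \<le> ennreal (2 ^ Suc k)" by (intro ennreal_leI one_le_power) simp
            then show "1 \<le> f k y" using 1 by (simp add: f_def del: power_Suc)
          qed
          also have "\<dots> \<le> (\<Sum>k. f k y)" by (intro sum_le_suminf) auto
          finally show ?thesis .
        qed
        then have "\<not> (\<Sum>k. f k y) < top"
          by (metis ennreal_Ex_less_of_nat ennreal_of_nat_eq_real_of_nat not_le)
        then have "(\<Sum>k. f k y) = top" using less_top by blast
        then show ?thesis by simp
      next
        case 2
        obtain k where k: "(1 / 2) ^ Suc k < dist x y" "dist x y \<le> (1 / 2) ^ k"
        proof -
          \<comment> \<open>By minimality the distance lies between the powers with exponents
            \<open>m\<close> and \<open>m - 1\<close>. The exponent \<open>m\<close> is not 0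
            because the distance is below 1.\<close>
          define m where "m = (LEAST m. (1 / 2 :: real) ^ m < dist x y)"
          obtain m' :: nat where "(1 / 2) ^ m' < dist x y"
            using real_arch_pow_inv[of "dist x y" "1 / 2"] 2 by auto
          then have m: "(1 / 2) ^ m < dist x y" unfolding m_def by (rule LeastI)
          then obtain k where k: "m = Suc k" using 2 by (cases m) auto
          have "\<not> (1 / 2) ^ k < dist x y"
            using not_less_Least[of k "\<lambda>m. (1 / 2 :: real) ^ m < dist x y"] k by (simp add: m_def)
          then show ?thesis using that m k by simp
        qed
        have "inverse (dist x y) \<le> 2 ^ Suc k"
          using k(1) 2(1) by (simp add: field_simps power_divide)
        then have "inverse (ennreal (dist x y)) \<le> f k y"
          using k(2) 2 by (simp add: f_def inverse_ennreal del: power_Suc)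
        also have "\<dots> \<le> (\<Sum>k. f k y)"
          using sum_le_suminf[of "\<lambda>k. f k y" "{k}"] by simp
        finally show ?thesis by (simp add: add_increasing)
      next
        case 3
        then have "inverse (ennreal (dist x y)) \<le> 1"
          by (subst inverse_ennreal) (auto simp: inverse_le_1_iff simp flip: ennreal_1)
        then show ?thesis by (simp add: add_increasing2)
      qed
    qed
    have "(\<integral>\<^sup>+y. inverse (ennreal (dist x y)) \<partial>\<mu>) \<le> (\<integral>\<^sup>+y. 1 + (\<Sum>k. f k y) \<partial>\<mu>)"
      by (intro nn_integral_mono pt)
    also have "\<dots> = emeasure \<mu> (space \<mu>) + (\<Sum>k. \<integral>\<^sup>+y. f k y \<partial>\<mu>)"
      by (simp add: nn_integral_add nn_integral_suminf)
    also have "\<dots> \<le> B"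
      unfolding B_def
    proof (intro add_left_mono suminf_le)
      fix k
      have "(\<integral>\<^sup>+y. f k y \<partial>\<mu>) = ennreal (2 ^ Suc k) * emeasure \<mu> (cball x ((1 / 2) ^ k))"
        unfolding f_def by (simp add: nn_integral_cmult_indicator sets_eq)
      also have "\<dots> \<le> ennreal (2 ^ Suc k) * ennreal (C * ((1 / 2) ^ k) powr \<alpha>)"
        using ball[of "(1 / 2) ^ k" x] C by (intro mult_left_mono) (auto simp: emeasure_eq_measure)
      also have "\<dots> = ennreal (2 ^ Suc k * (C * ((1 / 2) ^ k) powr \<alpha>))"
        using C by (simp add: ennreal_mult)
      also have "2 ^ Suc k * (C * ((1 / 2) ^ k) powr \<alpha>) = 2 * C * q ^ k"
        by (simp add: q_def powr_diff powr_power[symmetric] powr_divide power_divide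
            powr_realpow[symmetric] powr_powr mult.commute)
      finally show "(\<integral>\<^sup>+y. f k y \<partial>\<mu>) \<le> ennreal (2 * C * q ^ k)" .
    qed auto
    finally show ?thesis .
  qed
  ultimately show ?thesis by (rule that)
qed

section \<open>Upper and lower bounds for tents integrated over the slope\<close>

lemma emeasure_lborel_affine_window:
  fixes a b r :: real
  assumes "b \<noteq> 0" "0 \<le> r"
  shows "emeasure lborel {t. \<bar>a + t * b\<bar> \<le> r} = ennreal (2 * r / \<bar>b\<bar>)"
proof -
  have "{t. \<bar>a + t * b\<bar> \<le> r} = cball (- a / b) (r / \<bar>b\<bar>)"
  proof (intro set_eqI)
    fix t
    have "a + t * b = b * (t - (- a / b))" using assms by (simp add: field_simps)
    then have "\<bar>a + t * b\<bar> = \<bar>b\<bar> * \<bar>t - (- a / b)\<bar>" by (simp only: abs_mult)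
    also have "\<bar>t - (- a / b)\<bar> = dist (- a / b) t"
      unfolding dist_real_def by (rule abs_minus_commute)
    finally show "t \<in> {t. \<bar>a + t * b\<bar> \<le> r} \<longleftrightarrow> t \<in> cball (- a / b) (r / \<bar>b\<bar>)"
      using assms by (simp only: mem_Collect_eq mem_cball) (simp add: pos_le_divide_eq mult.commute)
  qed
  also have "\<dots> = {- a / b - r / \<bar>b\<bar> .. - a / b + r / \<bar>b\<bar>}" by (rule cball_eq_atLeastAtMost)
  finally show ?thesis using assms by (simp add: divide_nonneg_nonneg)
qed

lemma tent_le_indicator: "tent n d \<le> 2 ^ n * indicator {d. \<bar>d\<bar> \<le> 1 / 2 ^ n} d"
proof (cases "\<bar>d\<bar> \<le> 1 / 2 ^ n")
  case True
  have "tent n d \<le> ennreal (2 ^ n)"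
    unfolding tent_def by (intro ennreal_leI) (simp add: mult_left_le)
  then show ?thesis using True by (simp add: ennreal_power flip: ennreal_numeral)
next
  case False
  then have "2 ^ n * (1 - 2 ^ n * \<bar>d\<bar>) \<le> 0"
    by (simp add: mult_le_0_iff field_simps)
  then show ?thesis by (simp add: tent_def ennreal_neg)
qed

text \<open>With \<open>u = 2 ^ n * \<bar>d\<bar>\<close> this is \<open>u * (1 - u) <= 1\<close>.
  The bound is uniform in \<open>n\<close>, which serves slopes whose projection keeps a pair of
  points apart.\<close>

lemma tent_le_inverse:
  assumes "d \<noteq> 0"
  shows "tent n d \<le> ennreal (1 / \<bar>d\<bar>)"
proof -
  define u where "u = 2 ^ n * \<bar>d\<bar>"
  have "u * (1 - u) \<le> 1" using zero_le_power2[of "u - 1/2"] by (simp add: power2_eq_square algebra_simps)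
  then have "2 ^ n * (1 - 2 ^ n * \<bar>d\<bar>) \<le> 1 / \<bar>d\<bar>"
    using assms by (simp add: u_def field_simps)
  then show ?thesis unfolding tent_def by (rule ennreal_leI)
qed

lemma tent_ge:
  assumes "\<bar>d\<bar> \<le> 1 / 2 ^ Suc n"
  shows "tent n d \<ge> ennreal (2 ^ n / 2)"
proof -
  have "2 ^ n * \<bar>d\<bar> \<le> 1 / 2" using assms by (simp add: field_simps)
  then have "2 ^ n * (1 / 2) \<le> (2 ^ n * (1 - 2 ^ n * \<bar>d\<bar>) :: real)" by (intro mult_left_mono) auto
  then show ?thesis unfolding tent_def by (intro ennreal_leI) simp
qed

text \<open>For \<open>N = 0\<close> the right-hand side is infinite, so no pair on the diagonal has to be excluded.\<close>

lemma tent_slope_integral_le: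
  fixes a b N :: real
  assumes N: "0 \<le> N" "N \<le> \<bar>a\<bar> + \<bar>b\<bar>"
  shows "(\<integral>\<^sup>+t. tent n (a + t * b) * indicator {-2<..<2} t \<partial>lborel) \<le> 10 * inverse (ennreal N)"
proof -
  \<comment> \<open>If \<open>b\<close> dominates, the tent has height \<open>2 ^ n\<close> and
    lives on slopes of total length \<open>2 / (2 ^ n * \<bar>b\<bar>)\<close>, and
    \<open>N <= 5 * \<bar>b\<bar>\<close>. If \<open>a\<close> dominates, \<open>a + t * b\<close>
    stays at least \<open>\<bar>a\<bar> / 2\<close> in size on the interval of length 4, giving
    \<open>8 / \<bar>a\<bar>\<close> with \<open>N <= 5 / 4 * \<bar>a\<bar>\<close>. Both cases lead
    to the constant 10.\<close>
  consider "N = 0" | "N > 0" "\<bar>a\<bar> \<le> 4 * \<bar>b\<bar>" | "N > 0" "4 * \<bar>b\<bar> < \<bar>a\<bar>" using N by linarith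
  then show ?thesis
  proof cases
    case 1
    then show ?thesis by (simp add: ennreal_mult_top)
  next
    case 2
    then have b: "b \<noteq> 0" using N by auto
    have "(\<integral>\<^sup>+t. tent n (a + t * b) * indicator {-2<..<2} t \<partial>lborel)
        \<le> (\<integral>\<^sup>+t. 2 ^ n * indicator {t. \<bar>a + t * b\<bar> \<le> 1 / 2 ^ n} t \<partial>lborel)"
    proof (intro nn_integral_mono)
      fix t
      have "tent n (a + t * b) * indicator {-2<..<2} t \<le> tent n (a + t * b)"
        by (simp split: split_indicator)
      also have "\<dots> \<le> 2 ^ n * indicator {d. \<bar>d\<bar> \<le> 1 / 2 ^ n} (a + t * b)"
        by (rule tent_le_indicator)
      finally show "tent n (a + t * b) * indicator {-2<..<2} t
          \<le> 2 ^ n * indicator {t. \<bar>a + t * b\<bar> \<le> 1 / 2 ^ n} t"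
        by (simp add: indicator_def)
    qed
    also have "\<dots> = 2 ^ n * ennreal (2 * (1 / 2 ^ n) / \<bar>b\<bar>)"
      using b by (simp add: nn_integral_cmult_indicator emeasure_lborel_affine_window)
    also have "\<dots> = ennreal (2 / \<bar>b\<bar>)"
      by (simp add: ennreal_power flip: ennreal_numeral ennreal_mult')
    also have "\<dots> \<le> ennreal (10 * inverse N)"
      using 2 b N by (intro ennreal_leI) (simp add: field_simps)
    also have "\<dots> = 10 * inverse (ennreal N)"
      using 2 by (simp add: ennreal_mult' inverse_ennreal)
    finally show ?thesis .
  next
    case 3
    have "(\<integral>\<^sup>+t. tent n (a + t * b) * indicator {-2<..<2} t \<partial>lborel)
        \<le> (\<integral>\<^sup>+t. ennreal (2 / \<bar>a\<bar>) * indicator {-2<..<2::real} t \<partial>lborel)"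
    proof (intro nn_integral_mono)
      fix t :: real
      show "tent n (a + t * b) * indicator {-2<..<2} t \<le> ennreal (2 / \<bar>a\<bar>) * indicator {-2<..<2} t"
      proof (cases "t \<in> {-2<..<2}")
        case True
        then have "\<bar>t * b\<bar> \<le> 2 * \<bar>b\<bar>" by (auto simp: abs_mult intro!: mult_right_mono)
        then have ab: "\<bar>a\<bar> / 2 \<le> \<bar>a + t * b\<bar>" using 3 by linarith
        then have "tent n (a + t * b) \<le> ennreal (1 / \<bar>a + t * b\<bar>)"
          using 3 by (intro tent_le_inverse) auto
        also have "1 / \<bar>a + t * b\<bar> \<le> 1 / (\<bar>a\<bar> / 2)"
          using ab 3 by (intro frac_le) auto
        also have "1 / (\<bar>a\<bar> / 2) = 2 / \<bar>a\<bar>" by simp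
        finally have "tent n (a + t * b) \<le> ennreal (2 / \<bar>a\<bar>)" by (simp add: ennreal_leI)
        then show ?thesis using True by simp
      qed simp
    qed
    also have "\<dots> = ennreal (2 / \<bar>a\<bar>) * ennreal 4"
      by (simp add: nn_integral_cmult_indicator)
    also have "\<dots> = ennreal (8 / \<bar>a\<bar>)" by (subst ennreal_mult''[symmetric]) simp_all
    also have "\<dots> \<le> ennreal (10 * inverse N)"
      using 3 N by (intro ennreal_leI) (simp add: field_simps)
    also have "\<dots> = 10 * inverse (ennreal N)"
      using 3 by (simp add: ennreal_mult' inverse_ennreal)
    finally show ?thesis .
  qed
qed

text \<open>As \<open>n\<close> grows the tent concentrates at the slope \<open>- a / b\<close>, so
  all of its inner half ends up in \<open>U\<close>. There the height is at least
  \<open>2 ^ n / 2\<close> on a set of slopes of length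
  \<open>1 / (2 ^ n * \<bar>b\<bar>)\<close>.\<close>

lemma eventually_tent_slope_integral_ge:
  fixes a b :: real
  assumes b: "b \<noteq> 0" and "open U" and U: "- a / b \<in> U"
  shows "eventually (\<lambda>n. ennreal (1 / (2 * \<bar>b\<bar>)) \<le> (\<integral>\<^sup>+t. tent n (a + t * b) * indicator U t \<partial>lborel)) sequentially"
proof -
  obtain e where e: "e > 0" "cball (- a / b) e \<subseteq> U"
    using \<open>open U\<close> U open_contains_cball by blast
  have "(\<lambda>n. (1 / 2) ^ n :: real) \<longlonglongrightarrow> 0" by (rule LIMSEQ_power_zero) auto
  then have "eventually (\<lambda>n. (1 / 2) ^ n < e * \<bar>b\<bar>) sequentially"
    using e b by (intro order_tendstoD(2)) auto
  then show ?thesis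
  proof (rule eventually_mono)
    fix n assume n: "(1 / 2) ^ n < e * \<bar>b\<bar>"
    define r :: real where "r = 1 / 2 ^ Suc n"
    have "r \<le> (1 / 2) ^ n" by (simp add: r_def power_divide field_simps)
    then have r: "0 < r" "r < e * \<bar>b\<bar>" using n by (auto simp: r_def)
    have "ennreal (1 / (2 * \<bar>b\<bar>)) = ennreal (2 ^ n / 2) * ennreal (2 * r / \<bar>b\<bar>)"
      by (simp add: r_def flip: ennreal_mult')
    also have "\<dots> = (\<integral>\<^sup>+t. ennreal (2 ^ n / 2) * indicator {t. \<bar>a + t * b\<bar> \<le> r} t \<partial>lborel)"
      using b r by (simp add: nn_integral_cmult_indicator emeasure_lborel_affine_window)
    also have "\<dots> \<le> (\<integral>\<^sup>+t. tent n (a + t * b) * indicator U t \<partial>lborel)"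
    proof (intro nn_integral_mono)
      fix t
      show "ennreal (2 ^ n / 2) * indicator {t. \<bar>a + t * b\<bar> \<le> r} t \<le> tent n (a + t * b) * indicator U t"
      proof (cases "\<bar>a + t * b\<bar> \<le> r")
        case True
        have "a + t * b = b * (t - (- a / b))" using b by (simp add: field_simps)
        then have "\<bar>a + t * b\<bar> = \<bar>b\<bar> * \<bar>t - (- a / b)\<bar>" by (simp only: abs_mult)
        then have "\<bar>t - (- a / b)\<bar> * \<bar>b\<bar> \<le> e * \<bar>b\<bar>" using True r by (simp add: mult.commute)
        then have "\<bar>t - (- a / b)\<bar> \<le> e" using b by simp
        then have "t \<in> U" using e(2) by (auto simp: dist_real_def abs_minus_commute)
        then show ?thesis using True tent_ge[of "a + t * b" n] by (simp add: r_def)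
      qed simp
    qed
    finally show "ennreal (1 / (2 * \<bar>b\<bar>)) \<le> (\<integral>\<^sup>+t. tent n (a + t * b) * indicator U t \<partial>lborel)" .
  qed
qed

section \<open>Energies of projections\<close>

text \<open>
  Taking \<open>(i, j)\<close> to be \<open>(1, 2)\<close> or \<open>(2, 1)\<close> and \<open>\<bar>t\<bar> \<le> 1\<close> covers all directions; \<open>slope_proj i j t\<close>
  is constant along \<open>w\<close> exactly when \<open>t = - w\<^sub>i / w\<^sub>j\<close>.
\<close>

definition slope_proj :: "2 \<Rightarrow> 2 \<Rightarrow> real \<Rightarrow> real ^ 2 \<Rightarrow> real" where
  "slope_proj i j t x = x $ i + t * x $ j"

lemma slope_proj_diff: "slope_proj i j t (x - y) = slope_proj i j t x - slope_proj i j t y"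
  by (simp add: slope_proj_def algebra_simps)

lemma continuous_on_slope_proj: "continuous_on S (slope_proj i j t)"
  unfolding slope_proj_def by (intro continuous_intros)

lemma borel_measurable_vec_component [measurable (raw)]:
  fixes f :: "'a \<Rightarrow> real ^ 'n"
  assumes "f \<in> borel_measurable M"
  shows "(\<lambda>w. f w $ k) \<in> borel_measurable M"
  by (rule measurable_compose[OF assms])
     (intro borel_measurable_continuous_onI continuous_intros)

lemma measurable_slope_proj [measurable (raw)]:
  assumes [measurable]: "f \<in> borel_measurable M" "g \<in> borel_measurable M"
  shows "(\<lambda>w. slope_proj i j (f w) (g w)) \<in> borel_measurable M"
  unfolding slope_proj_def by measurable

locale finite_plane_measure = finite_measure \<mu> for \<mu> :: "(real ^ 2) measure" +
  assumes sets_eq [simp, measurable_cong]: "sets \<mu> = sets borel"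
begin

sublocale PP: finite_measure "\<mu> \<Otimes>\<^sub>M \<mu>"
  by (intro finite_measure_pair_measure finite_measure_axioms)

text \<open>Written over pairs of points, so that \<open>t\<close> enters only through a kernel that
  is continuous in \<open>t\<close>. Fubini and Fatou then apply directly.\<close>

definition proj_energy :: "2 \<Rightarrow> 2 \<Rightarrow> nat \<Rightarrow> real \<Rightarrow> ennreal" where
  "proj_energy i j n t = (\<integral>\<^sup>+z. tent n (slope_proj i j t (fst z - snd z)) \<partial>(\<mu> \<Otimes>\<^sub>M \<mu>))"

definition sup_energy :: "2 \<Rightarrow> 2 \<Rightarrow> real \<Rightarrow> ennreal" where
  "sup_energy i j t = (SUP n. proj_energy i j n t)"

lemma finite_measure_distr_slope_proj: "finite_measure (distr \<mu> borel (slope_proj i j t))"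
  by (rule finite_measure_distr) measurable

lemma proj_energy_eq_dyadic_energy:
  "proj_energy i j n t = dyadic_energy n (distr \<mu> borel (slope_proj i j t))"
proof -
  have "dyadic_energy n (distr \<mu> borel (slope_proj i j t))
      = (\<integral>\<^sup>+x. \<integral>\<^sup>+y. tent n (slope_proj i j t (x - y)) \<partial>\<mu> \<partial>\<mu>)"
    by (simp add: dyadic_energy_eq_tent finite_measure_distr_slope_proj nn_integral_distr slope_proj_diff)
  also have "\<dots> = proj_energy i j n t"
    unfolding proj_energy_def by (subst nn_integral_fst[symmetric]) simp_all
  finally show ?thesis by simp
qed

lemma proj_energy_mono: "m \<le> n \<Longrightarrow> proj_energy i j m t \<le> proj_energy i j n t"
  unfolding proj_energy_eq_dyadic_energy
  by (rule lift_Suc_mono_le[of "\<lambda>n. dyadic_energy n _"])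
     (simp_all add: dyadic_energy_Suc finite_measure_distr_slope_proj)

text \<open>The criterion on the line is applied to the pushforward of \<open>\<mu>\<close>, which
  gives the image of \<open>K\<close> at least the mass of \<open>K\<close>.\<close>

lemma emeasure_slope_proj_image_pos:
  assumes "sup_energy i j t < top" "compact K" "emeasure \<mu> K > 0"
  shows "emeasure lborel (slope_proj i j t ` K) > 0"
proof (rule emeasure_compact_pos_if_dyadic_energy_bounded)
  let ?m = "distr \<mu> borel (slope_proj i j t)"
  show comp: "compact (slope_proj i j t ` K)"
    by (intro compact_continuous_image continuous_on_slope_proj assms)
  show "(SUP n. dyadic_energy n ?m) < top"
    using assms(1) by (simp add: sup_energy_def proj_energy_eq_dyadic_energy)
  have "emeasure \<mu> K \<le> emeasure \<mu> (slope_proj i j t -` (slope_proj i j t ` K) \<inter> space \<mu>)"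
  proof (rule emeasure_mono)
    show "K \<subseteq> slope_proj i j t -` (slope_proj i j t ` K) \<inter> space \<mu>"
      using sets_eq_imp_space_eq[OF sets_eq] by auto
    show "slope_proj i j t -` (slope_proj i j t ` K) \<inter> space \<mu> \<in> sets \<mu>"
      using comp by (intro measurable_sets[where A = borel]) (auto simp: borel_compact)
  qed
  then show "emeasure ?m (slope_proj i j t ` K) > 0"
    using assms(3) comp by (subst emeasure_distr) (auto simp: borel_compact)
qed (simp_all add: finite_measure_distr_slope_proj)

lemma measurable_proj_energy [measurable]: "proj_energy i j n \<in> borel_measurable borel"
  unfolding proj_energy_def by measurable

lemma measurable_sup_energy [measurable]: "sup_energy i j \<in> borel_measurable borel"
  unfolding sup_energy_def by measurable

text \<open>Fatou's lemma makes the energy lower semicontinuous in \<open>t\<close>. Openness is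
  what lets the concentrating tents be localised to slopes of large energy.\<close>

lemma open_proj_energy_gt: "open {t. c < proj_energy i j n t}"
proof -
  have "closed {t. proj_energy i j n t \<le> c}"
    unfolding closed_sequential_limits
  proof safe
    fix u t assume u: "\<forall>k. u k \<in> {t. proj_energy i j n t \<le> c}" and lim: "u \<longlonglongrightarrow> t"
    have "(\<lambda>k. tent n (slope_proj i j (u k) z)) \<longlonglongrightarrow> tent n (slope_proj i j t z)" for z
      unfolding tent_def slope_proj_def by (intro tendsto_intros lim)
    then have "proj_energy i j n t
        = (\<integral>\<^sup>+z. liminf (\<lambda>k. tent n (slope_proj i j (u k) (fst z - snd z))) \<partial>(\<mu> \<Otimes>\<^sub>M \<mu>))"
      unfolding proj_energy_def by (intro nn_integral_cong lim_imp_Liminf[symmetric]) auto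
    also have "\<dots> \<le> liminf (\<lambda>k. proj_energy i j n (u k))"
      unfolding proj_energy_def by (intro nn_integral_liminf) measurable
    also have "\<dots> \<le> c" using u by (intro Liminf_le) auto
    finally show "proj_energy i j n t \<le> c" .
  qed
  moreover have "{t. c < proj_energy i j n t} = - {t. proj_energy i j n t \<le> c}" by auto
  ultimately show ?thesis by (simp add: open_Compl)
qed

lemma open_sup_energy_gt: "open {t. c < sup_energy i j t}"
proof -
  have "{t. c < sup_energy i j t} = (\<Union>n. {t. c < proj_energy i j n t})"
    by (auto simp: sup_energy_def less_SUP_iff)
  then show ?thesis by (simp add: open_UN open_proj_energy_gt)
qed

section \<open>Almost no pair points in a direction of infinite energy\<close>

lemma AE_sup_energy_finite:
  assumes "i \<noteq> j"
    and energy: "(\<integral>\<^sup>+x. \<integral>\<^sup>+y. inverse (ennreal (dist x y)) \<partial>\<mu> \<partial>\<mu>) < top"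
  shows "AE z in \<mu> \<Otimes>\<^sub>M \<mu>. let w = fst z - snd z in
           w $ j \<noteq> 0 \<and> \<bar>w $ i\<bar> \<le> \<bar>w $ j\<bar> \<longrightarrow> sup_energy i j (- (w $ i) / w $ j) < top"
proof -
  \<comment> \<open>The relevant slopes lie in [-1, 1]; the larger open interval \<open>?J\<close>
    makes all of them interior points.\<close>
  let ?P = "\<mu> \<Otimes>\<^sub>M \<mu>" and ?J = "{-2<..<2::real}" and ?F = "sup_energy i j"
  interpret PL: pair_sigma_finite ?P lborel ..
  define W where "W = (\<integral>\<^sup>+z. 10 * inverse (ennreal (norm (fst z - snd z))) \<partial>?P)"
  have "W = 10 * (\<integral>\<^sup>+x. \<integral>\<^sup>+y. inverse (ennreal (norm (x - y))) \<partial>\<mu> \<partial>\<mu>)"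
    unfolding W_def by (subst nn_integral_cmult, measurable) (subst nn_integral_fst[symmetric], simp_all)
  then have W: "W < top" using energy by (simp add: dist_norm ennreal_mult_less_top)
  have norm_le: "norm w \<le> \<bar>w $ i\<bar> + \<bar>w $ j\<bar>" for w :: "real ^ 2"
  proof -
    have "k = i \<or> k = j" for k
      using \<open>i \<noteq> j\<close> exhaust_2[of i] exhaust_2[of j] exhaust_2[of k] by auto
    then have U: "(UNIV :: 2 set) = {i, j}" by auto
    show ?thesis using norm_le_l1_cart[of w] \<open>i \<noteq> j\<close> unfolding U by simp
  qed
  have swap: "(\<integral>\<^sup>+z. \<integral>\<^sup>+t. tent n (slope_proj i j t (fst z - snd z)) * indicator U t \<partial>lborel \<partial>?P)
      = (\<integral>\<^sup>+t. proj_energy i j n t * indicator U t \<partial>lborel)" if [measurable]: "U \<in> sets borel" for n U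
  proof -
    have "(\<integral>\<^sup>+z. \<integral>\<^sup>+t. tent n (slope_proj i j t (fst z - snd z)) * indicator U t \<partial>lborel \<partial>?P)
        = (\<integral>\<^sup>+t. \<integral>\<^sup>+z. tent n (slope_proj i j t (fst z - snd z)) * indicator U t \<partial>?P \<partial>lborel)"
      by (rule PL.Fubini'[symmetric]) measurable
    then show ?thesis by (simp add: proj_energy_def nn_integral_multc)
  qed
  have "(\<integral>\<^sup>+t. proj_energy i j n t * indicator ?J t \<partial>lborel) \<le> W" for n
    unfolding swap[OF borel_open[OF open_greaterThanLessThan], symmetric] W_def slope_proj_def
    by (intro nn_integral_mono tent_slope_integral_le norm_ge_zero norm_le)
  \<comment> \<open>Monotonicity of the energies in \<open>n\<close> is essential here: it lets the
    uniform bound \<open>W\<close> pass to the integral of the supremum.\<close>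
  moreover have "(\<integral>\<^sup>+t. ?F t * indicator ?J t \<partial>lborel)
      = (SUP n. \<integral>\<^sup>+t. proj_energy i j n t * indicator ?J t \<partial>lborel)"
    unfolding sup_energy_def
    by (subst nn_integral_monotone_convergence_SUP[symmetric])
       (auto simp: incseq_def le_fun_def proj_energy_mono mult_right_mono SUP_mult_right_ennreal)
  ultimately have F_int: "(\<integral>\<^sup>+t. ?F t * indicator ?J t \<partial>lborel) < top"
    using W by (metis (mono_tags, lifting) SUP_least le_less_trans)
  define A where "A R = {t. of_nat R < ?F t} \<inter> ?J" for R :: nat
  have A_open: "open (A R)" for R
    unfolding A_def by (intro open_Int open_sup_energy_gt) simp
  have [measurable]: "A R \<in> sets borel" for R by (simp add: A_open borel_open)
  \<comment> \<open>\<open>?F\<close> is integrable on \<open>?J\<close>, hence finite at almost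
    every slope \<open>t\<close> there, and such a \<open>t\<close> leaves \<open>A R\<close> once
    \<open>R\<close> exceeds \<open>?F t\<close>.\<close>
  have tail: "(\<lambda>R. \<integral>\<^sup>+t. ?F t * indicator (A R) t \<partial>lborel) \<longlonglongrightarrow> (\<integral>\<^sup>+t. 0 \<partial>(lborel :: real measure))"
  proof (rule nn_integral_dominated_convergence[where w = "\<lambda>t. ?F t * indicator ?J t"])
    have "AE t in lborel. ?F t * indicator ?J t \<noteq> \<infinity>"
      using F_int by (intro nn_integral_PInf_AE) auto
    then show "AE t in lborel. (\<lambda>R. ?F t * indicator (A R) t) \<longlonglongrightarrow> 0"
    proof (rule AE_mp, intro AE_I2 impI)
      fix t assume fin: "?F t * indicator ?J t \<noteq> \<infinity>"
      show "(\<lambda>R. ?F t * indicator (A R) t) \<longlonglongrightarrow> 0"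
      proof (cases "t \<in> ?J")
        case True
        then obtain N :: nat where N: "?F t < of_nat N"
          using fin ennreal_Ex_less_of_nat[of "?F t"] by (auto simp: less_top)
        have "eventually (\<lambda>R. ?F t * indicator (A R) t = 0) sequentially"
          using eventually_ge_at_top[of N]
        proof (rule eventually_mono)
          fix R assume "N \<le> R"
          then have "?F t < of_nat R" using N by (meson less_le_trans of_nat_mono)
          then show "?F t * indicator (A R) t = 0" by (auto simp: A_def indicator_def)
        qed
        then show ?thesis by (rule tendsto_eventually)
      qed (simp add: A_def)
    qed
  qed (use F_int in \<open>auto simp: A_def split: split_indicator\<close>)
  define Q where "Q = {z. let w = fst z - snd z :: real ^ 2 in
      w $ j \<noteq> 0 \<and> \<bar>w $ i\<bar> \<le> \<bar>w $ j\<bar> \<and> ?F (- (w $ i) / w $ j) = top}"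
  have [measurable]: "Measurable.pred ?P (\<lambda>z. z \<in> Q)"
    unfolding Q_def Let_def mem_Collect_eq by measurable
  \<comment> \<open>The weight is the lower bound from the concentration of tents. It is positive on
    the set \<open>Q\<close> of bad pairs, so \<open>Q\<close> is null as soon as the integral of
    \<open>c\<close> vanishes.\<close>
  define c :: "(real ^ 2) \<times> (real ^ 2) \<Rightarrow> ennreal"
    where "c z = (if z \<in> Q then ennreal (1 / (2 * \<bar>(fst z - snd z) $ j\<bar>)) else 0)" for z
  have [measurable]: "c \<in> borel_measurable ?P" unfolding c_def by measurable
  have "integral\<^sup>N ?P c \<le> (\<integral>\<^sup>+t. ?F t * indicator (A R) t \<partial>lborel)" for R
  proof -
    have "c z \<le> liminf (\<lambda>n. \<integral>\<^sup>+t. tent n (slope_proj i j t (fst z - snd z)) * indicator (A R) t \<partial>lborel)" for z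
    proof (cases "z \<in> Q")
      case True
      define a b where "a = (fst z - snd z) $ i" and "b = (fst z - snd z) $ j"
      have b: "b \<noteq> 0" "\<bar>a\<bar> \<le> \<bar>b\<bar>" "?F (- a / b) = top"
        using True by (simp_all add: Q_def a_def b_def Let_def del: vector_minus_component)
      then have "\<bar>- a / b\<bar> \<le> 1" by (simp add: abs_divide)
      then have "- a / b \<in> ?J" unfolding greaterThanLessThan_iff by linarith
      \<comment> \<open>Infinite energy exceeds every threshold, so the direction of a bad pair lies
        in \<open>A R\<close> whatever \<open>R\<close> is.\<close>
      then have "- a / b \<in> A R" unfolding A_def using b(3) by (simp add: of_nat_less_top)
      from eventually_tent_slope_integral_ge[OF b(1) A_open this]
      have "ennreal (1 / (2 * \<bar>b\<bar>)) \<le> liminf (\<lambda>n. \<integral>\<^sup>+t. tent n (a + t * b) * indicator (A R) t \<partial>lborel)"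
        by (rule Liminf_bounded)
      then show ?thesis using True by (simp add: c_def slope_proj_def a_def b_def)
    qed (simp add: c_def)
    then have "integral\<^sup>N ?P c \<le>
        (\<integral>\<^sup>+z. liminf (\<lambda>n. \<integral>\<^sup>+t. tent n (slope_proj i j t (fst z - snd z)) * indicator (A R) t \<partial>lborel) \<partial>?P)"
      by (intro nn_integral_mono)
    \<comment> \<open>Fatou's lemma over pairs; \<open>swap\<close> then turns the result into an
      integral of energies over \<open>A R\<close>, where \<open>?F\<close> dominates each of
      them.\<close>
    also have "\<dots> \<le> liminf (\<lambda>n. \<integral>\<^sup>+z. \<integral>\<^sup>+t. tent n (slope_proj i j t (fst z - snd z)) * indicator (A R) t \<partial>lborel \<partial>?P)"
      by (rule nn_integral_liminf) measurable
    also have "\<dots> = liminf (\<lambda>n. \<integral>\<^sup>+t. proj_energy i j n t * indicator (A R) t \<partial>lborel)"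
      by (simp add: swap)
    also have "\<dots> \<le> (\<integral>\<^sup>+t. ?F t * indicator (A R) t \<partial>lborel)"
      by (intro Liminf_le eventuallyI allI always_eventually nn_integral_mono mult_right_mono)
         (auto simp: sup_energy_def intro: SUP_upper)
    finally show ?thesis .
  qed
  then have "integral\<^sup>N ?P c \<le> (\<integral>\<^sup>+t. 0 \<partial>(lborel :: real measure))"
    by (intro LIMSEQ_le_const[OF tail]) auto
  then have "integral\<^sup>N ?P c = 0" by simp
  then have "AE z in ?P. c z = 0" by (simp add: nn_integral_0_iff_AE)
  then show ?thesis
  proof (rule AE_mp, intro AE_I2 impI)
    fix z assume "c z = 0"
    then have "z \<notin> Q" by (auto simp: c_def Q_def Let_def split: if_splits)
    then show "let w = fst z - snd z in
        w $ j \<noteq> 0 \<and> \<bar>w $ i\<bar> \<le> \<bar>w $ j\<bar> \<longrightarrow> sup_energy i j (- (w $ i) / w $ j) < top"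
      by (auto simp: Q_def Let_def less_top)
  qed
qed

end

section \<open>Areas of triangles\<close>

text \<open>The product of the restrictions has a density with respect to the full product, so null
  sets of the latter stay null.\<close>

lemma AE_pair_restrict_measure:
  assumes "finite_measure \<mu>" "A \<in> sets \<mu>" "B \<in> sets \<mu>" and "AE z in \<mu> \<Otimes>\<^sub>M \<mu>. Q z"
  shows "AE z in restrict_measure \<mu> A \<Otimes>\<^sub>M restrict_measure \<mu> B. Q z"
proof -
  interpret finite_measure \<mu> by fact
  note [measurable] = assms(2,3)
  have "finite_measure (density \<mu> (indicator B))"
  proof (rule finite_measureI)
    have "emeasure (density \<mu> (indicator B)) (space \<mu>) = emeasure \<mu> B"
      using assms(3) by (simp add: emeasure_restricted sets.Int_space_eq2)
    then show "emeasure (density \<mu> (indicator B)) (space (density \<mu> (indicator B))) \<noteq> \<infinity>"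
      by (simp add: emeasure_finite)
  qed
  then have "sigma_finite_measure (density \<mu> (indicator B))"
    by (rule finite_measure.axioms)
  then have eq: "restrict_measure \<mu> A \<Otimes>\<^sub>M restrict_measure \<mu> B
      = density (\<mu> \<Otimes>\<^sub>M \<mu>) (\<lambda>(x, y). indicator A x * indicator B y)"
    unfolding restrict_measure_def
    by (intro pair_measure_density sigma_finite_measure_axioms) simp_all
  have f: "(\<lambda>(x, y). indicator A x * indicator B y :: ennreal) \<in> borel_measurable (\<mu> \<Otimes>\<^sub>M \<mu>)"
    by measurable
  show ?thesis
    unfolding eq AE_density[OF f] using assms(4) by eventually_elim simp
qed

lemma triangle_area_eq:
  "triangle_area x y z = \<bar>(z $ 1 - x $ 1) * (y $ 2 - x $ 2) - (y $ 1 - x $ 1) * (z $ 2 - x $ 2)\<bar> / 2"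
proof -
  have "convex hull {x, y, z} \<in> sets borel"
    by (intro borel_compact compact_convex_hull finite_imp_compact) simp
  then show ?thesis
    by (simp add: triangle_area_def content_triangle measure_completion)
qed

text \<open>With this slope the projection is constant along the line through \<open>x\<close> and
  \<open>y\<close>, so the difference of its values at \<open>z\<close> and \<open>x\<close> is
  proportional to the height of the triangle over that line.\<close>

lemma triangle_area_eq_slope_proj:
  assumes "i \<noteq> j" and w: "w = x - y" "w $ j \<noteq> 0"
  shows "triangle_area x y z
    = \<bar>w $ j\<bar> / 2 * \<bar>slope_proj i j (- (w $ i) / w $ j) z - slope_proj i j (- (w $ i) / w $ j) x\<bar>"
proof -
  have "w $ j * (slope_proj i j (- (w $ i) / w $ j) z - slope_proj i j (- (w $ i) / w $ j) x)
      = w $ j * (z $ i - x $ i) - w $ i * (z $ j - x $ j)"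
    using w(2) by (simp add: slope_proj_def field_simps)
  moreover have "i = 1 \<and> j = 2 \<or> i = 2 \<and> j = 1"
    using \<open>i \<noteq> j\<close> exhaust_2[of i] exhaust_2[of j] by auto
  \<comment> \<open>The two orders of the coordinates differ by the sign of the determinant, which
    the absolute value absorbs.\<close>
  then have "\<bar>(z $ 1 - x $ 1) * (y $ 2 - x $ 2) - (y $ 1 - x $ 1) * (z $ 2 - x $ 2)\<bar>
      = \<bar>w $ j * (z $ i - x $ i) - w $ i * (z $ j - x $ j)\<bar>"
    unfolding w(1) vector_minus_component by (elim disjE; simp add: algebra_simps)
  ultimately show ?thesis
    unfolding triangle_area_eq by (simp add: abs_mult[symmetric])
qed

text \<open>The area determines the projected point up to reflection about the projection of
  \<open>x\<close>, so the projection of \<open>K\<close> is covered by two affine images of the set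
  of areas. If that set were null, so would be the projection.\<close>

lemma triangle_areas_pos_if_slope_proj_pos:
  assumes "i \<noteq> j" and w: "w = x - y" "w $ j \<noteq> 0" and "compact K"
    and pos: "emeasure lborel (slope_proj i j (- (w $ i) / w $ j) ` K) > 0"
  shows "emeasure lebesgue {triangle_area x y z | z. z \<in> K} > 0"
proof (rule ccontr)
  let ?p = "slope_proj i j (- (w $ i) / w $ j)" and ?A = "{triangle_area x y z | z. z \<in> K}"
  assume "\<not> emeasure lebesgue ?A > 0"
  then have "emeasure lebesgue ?A = 0" by (simp add: zero_less_iff_neq_zero)
  \<comment> \<open>Measurability has to be secured first, since \<open>emeasure\<close> is 0 by
    default on non-measurable sets.\<close>
  moreover have "compact ?A"
  proof -
    have "continuous_on K (triangle_area x y)"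
      unfolding triangle_area_eq[abs_def] by (intro continuous_intros) auto
    then show ?thesis
      using compact_continuous_image[OF _ \<open>compact K\<close>] by (simp add: Setcompr_eq_image)
  qed
  then have "?A \<in> sets lebesgue" by (simp add: lmeasurable_compact fmeasurableD)
  ultimately have neg: "negligible ?A" by (simp add: negligible_iff_emeasure0)
  define c where "c = 2 / \<bar>w $ j\<bar>"
  have c: "\<bar>?p z - ?p x\<bar> = c * triangle_area x y z" for z
    using w(2) by (simp add: c_def triangle_area_eq_slope_proj[OF assms(1) w])
  have "?p ` K \<subseteq> (\<lambda>a. ?p x + c * a) ` ?A \<union> (\<lambda>a. ?p x - c * a) ` ?A"
  proof (rule image_subsetI)
    fix z assume z: "z \<in> K"
    have "?p z = ?p x + c * triangle_area x y z \<or> ?p z = ?p x - c * triangle_area x y z"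
      using c[of z] by linarith
    then show "?p z \<in> (\<lambda>a. ?p x + c * a) ` ?A \<union> (\<lambda>a. ?p x - c * a) ` ?A"
      using z by blast
  qed
  moreover have "negligible ((\<lambda>a. ?p x + c * a) ` ?A \<union> (\<lambda>a. ?p x - c * a) ` ?A)"
    by (intro negligible_Un negligible_differentiable_image_negligible neg derivative_intros) auto
  ultimately have "negligible (?p ` K)" using negligible_subset by blast
  moreover have "compact (?p ` K)"
    by (intro compact_continuous_image continuous_on_slope_proj \<open>compact K\<close>)
  ultimately have "emeasure lborel (?p ` K) = 0"
    by (simp add: negligible_iff_emeasure0 lmeasurable_compact fmeasurableD borel_compact)
  then show False using pos by simp
qed

section \<open>Positive length of the set of areas for almost every pair\<close>

theorem theorem1p5:
  fixes E E1 E2 E3 :: "(real ^ 2) set" and \<mu> :: "(real ^ 2) measure" and \<alpha> :: real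
  assumes "compact E" and "hausdorff_dim E > 1"
    and "\<alpha> > 1" and "frostman_measure \<alpha> E \<mu>"
    and "compact E1" and "compact E2" and "compact E3"
    and "E1 \<subseteq> E" and "E2 \<subseteq> E" and "E3 \<subseteq> E"
    and "E1 \<inter> E2 = {}" and "E1 \<inter> E3 = {}" and "E2 \<inter> E3 = {}"
    and "emeasure \<mu> E1 > 0" and "emeasure \<mu> E2 > 0" and "emeasure \<mu> E3 > 0"
  shows "AE (x1, x2) in restrict_measure \<mu> E1 \<Otimes>\<^sub>M restrict_measure \<mu> E2.
           x1 \<in> E1 \<and> x2 \<in> E2 \<longrightarrow>
           emeasure lebesgue {triangle_area x1 x2 x3 | x3. x3 \<in> E3} > 0"
proof -
  obtain C where fin: "finite_measure \<mu>" and sets: "sets \<mu> = sets borel"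
    and C: "\<And>x r. r > 0 \<Longrightarrow> measure \<mu> (cball x r) \<le> C * r powr \<alpha>"
    using assms(4) unfolding frostman_measure_def by blast
  interpret finite_plane_measure \<mu>
    using fin sets by (simp add: finite_plane_measure_def finite_plane_measure_axioms_def)
  obtain B where B: "B < top" "\<And>x. (\<integral>\<^sup>+y. inverse (ennreal (dist x y)) \<partial>\<mu>) \<le> B"
    using inverse_dist_integral_bounded[OF fin sets \<open>\<alpha> > 1\<close> C] by blast
  have "(\<integral>\<^sup>+x. \<integral>\<^sup>+y. inverse (ennreal (dist x y)) \<partial>\<mu> \<partial>\<mu>) \<le> (\<integral>\<^sup>+x. B \<partial>\<mu>)"
    by (intro nn_integral_mono B)
  also have "\<dots> < top"
    using B(1) emeasure_finite[of "space \<mu>"]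
    by (simp add: ennreal_mult_eq_top_iff less_top[symmetric])
  finally have energy: "(\<integral>\<^sup>+x. \<integral>\<^sup>+y. inverse (ennreal (dist x y)) \<partial>\<mu> \<partial>\<mu>) < top" .
  have neq: "(1 :: 2) \<noteq> 2" by simp
  \<comment> \<open>Proved for all pairs off the diagonal under the full product; restriction to
    \<open>E1\<close> and \<open>E2\<close> comes afterwards.\<close>
  have "AE z in \<mu> \<Otimes>\<^sub>M \<mu>. fst z \<noteq> snd z \<longrightarrow>
      emeasure lebesgue {triangle_area (fst z) (snd z) x3 | x3. x3 \<in> E3} > 0"
    using AE_sup_energy_finite[OF neq energy] AE_sup_energy_finite[OF neq[symmetric] energy]
  proof eventually_elim
    case (elim z)
    define w where "w = fst z - snd z"
    note fin_energy = elim[unfolded Let_def, folded w_def]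
    have *: "emeasure lebesgue {triangle_area (fst z) (snd z) x3 | x3. x3 \<in> E3} > 0"
      if "i \<noteq> j" "w $ j \<noteq> 0" "sup_energy i j (- (w $ i) / w $ j) < top" for i j
      using triangle_areas_pos_if_slope_proj_pos[OF that(1) w_def that(2) \<open>compact E3\<close>]
        emeasure_slope_proj_image_pos[OF that(3) \<open>compact E3\<close>] assms(16) by simp
    show ?case
    proof
      assume "fst z \<noteq> snd z"
      then have w: "w $ 1 \<noteq> 0 \<or> w $ 2 \<noteq> 0" by (simp add: w_def vec_eq_iff forall_2)
      show "emeasure lebesgue {triangle_area (fst z) (snd z) x3 | x3. x3 \<in> E3} > 0"
      \<comment> \<open>Dividing by the larger coordinate of \<open>w\<close> keeps the slope in
        [-1, 1] and the denominator nonzero.\<close>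
      proof (cases "\<bar>w $ 1\<bar> \<le> \<bar>w $ 2\<bar>")
        case True
        then have "w $ 2 \<noteq> 0" using w by auto
        then show ?thesis using *[OF neq] fin_energy(1) True by blast
      next
        case False
        then have "w $ 1 \<noteq> 0" "\<bar>w $ 2\<bar> \<le> \<bar>w $ 1\<bar>" by auto
        then show ?thesis using *[OF neq[symmetric]] fin_energy(2) by blast
      qed
    qed
  qed
  then have "AE z in restrict_measure \<mu> E1 \<Otimes>\<^sub>M restrict_measure \<mu> E2. fst z \<noteq> snd z \<longrightarrow>
      emeasure lebesgue {triangle_area (fst z) (snd z) x3 | x3. x3 \<in> E3} > 0"
    using \<open>compact E1\<close> \<open>compact E2\<close> by (intro AE_pair_restrict_measure fin) (auto simp: borel_compact)
  then show ?thesis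
    \<comment> \<open>Disjointness of \<open>E1\<close> and \<open>E2\<close> keeps the pairs in
      question off the diagonal.\<close>
    by eventually_elim (use \<open>E1 \<inter> E2 = {}\<close> in auto)
qed

end
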